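(* Let $\gamma\ge1$ be real and $\mathcal B$ a finite set of real numbers $\beta$ with $\beta\ge\gamma$ for all $\beta\in\mathcal B$. Let $G_\gamma=(0,\gamma)$ and $H=(0,a)\supset G_\gamma$ be open intervals, let $m$ be a positive integer, and for $s>0$ define $\Lambda_s:C^m(\bar H)\to C^m(\bar H)$ by $$(\Lambda_sf)(x)=\sum_{\beta\in\mathcal B}(x+\beta)^{-2s}f(1/(x+\beta)).$$ Then $\Lambda_s$ has a unique, normalized, strictly positive eigenvector $v_s$, $v_s$ is $C^\infty$, and for all $\nu\ge1$ and $x\in\bar H$, $$0\le(-1)^\nu\frac{D_1^\nu v_s(x)}{v_s(x)}\le\frac{(2s)(2s+1)\cdots(2s+\nu-1)}{\gamma^\nu},$$ where $D_1=d/dx$.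
   Context: $C^m(\bar H)$ is the Banach space of real $C^m$ functions on $H$ whose derivatives of order $\le m$ extend continuously to $\bar H$. *)

theory Defs
  imports "HOL-Analysis.Analysis"
begin

definition Cm_bar :: "nat \<Rightarrow> real \<Rightarrow> (real \<Rightarrow> real) \<Rightarrow> bool" where
  "Cm_bar m a f \<longleftrightarrow>
     (\<forall>k<m. \<forall>x\<in>{0<..<a}. ((deriv ^^ k) f) differentiable (at x)) \<and>
     continuous_on {0..a} f \<and>
     (\<forall>k\<in>{1..m}. \<exists>g. continuous_on {0..a} g \<and> (\<forall>x\<in>{0<..<a}. g x = (deriv ^^ k) f x))"

text \<open>The k-th derivative of f on closure H: on H the usual derivative, at the endpoints
its (continuous) extension, i.e. the limit from inside H.\<close>
definition Dbar :: "real \<Rightarrow> nat \<Rightarrow> (real \<Rightarrow> real) \<Rightarrow> real \<Rightarrow> real" where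
  "Dbar a k f x =
     (if k = 0 then f x
      else if 0 < x \<and> x < a then (deriv ^^ k) f x
      else Lim (at x within {0<..<a}) ((deriv ^^ k) f))"

definition Lambda_op :: "real \<Rightarrow> real set \<Rightarrow> (real \<Rightarrow> real) \<Rightarrow> real \<Rightarrow> real" where
  "Lambda_op s B f x = (\<Sum>\<beta>\<in>B. (x + \<beta>) powr (-2 * s) * f (1 / (x + \<beta>)))"

end

theory Submission
  imports Defs "HOL-Complex_Analysis.Great_Picard"
begin

text \<open>
For \<open>t \<ge> \<gamma>\<close> put \<open>\<phi>\<^sub>t(x) = (x + t)\<close> to the power \<open>-2s\<close>. Since
\<open>(x + \<beta>) (1/(x + \<beta>) + t) = t (x + \<beta> + 1/t)\<close>, the operator maps \<open>\<phi>\<^sub>t\<close> to a positive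
combination of the functions \<open>\<phi>\<close> with parameter \<open>\<beta> + 1/t \<ge> \<gamma>\<close>, so it preserves the convex
cone they generate (together with the constants). The derivative bounds are evident for each
\<open>\<phi>\<^sub>t\<close> and are linear, so they hold on the cone. The elements of the cone extend
holomorphically to \<open>Re z > -\<gamma>\<close> and are bounded on compact sets by their value at 0.
The Cesaro means of the suitably scaled iterates of the constant 1 lie in the cone, and by Montel's
theorem a subsequence converges together with all derivatives; the limit is the eigenvector.

For uniqueness, a minimum point of the ratio \<open>w/v\<close> of two positive eigenvectors is carried by
every branch \<open>x \<mapsto> 1/(x + \<beta>)\<close> to another one, and the orbit of a branch tends to its fixed
point. So the minimum of \<open>w/v\<close>, and likewise its maximum, is attained at this fixed point.
\<close>

section \<open>The cone of shifted powers: closure, derivatives and bounds\<close>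

text \<open>Powers use the principal branch: for \<open>\<gamma> \<le> t\<close>, shifting the
  half-plane \<open>- \<gamma> < Re z\<close> by \<open>t\<close> avoids the branch cut, so every
  generator is holomorphic there. Constants are included so that the iteration can start at
  1.\<close>

inductive_set pole_cone :: "real \<Rightarrow> real \<Rightarrow> (complex \<Rightarrow> complex) set" for \<gamma> \<sigma> :: real where
  const: "0 \<le> c \<Longrightarrow> (\<lambda>_. of_real c) \<in> pole_cone \<gamma> \<sigma>"
| pole: "0 \<le> c \<Longrightarrow> \<gamma> \<le> t \<Longrightarrow>
    (\<lambda>z. of_real c * (z + of_real t) powr (- of_real \<sigma>)) \<in> pole_cone \<gamma> \<sigma>"
| add: "f \<in> pole_cone \<gamma> \<sigma> \<Longrightarrow> g \<in> pole_cone \<gamma> \<sigma> \<Longrightarrow> (\<lambda>z. f z + g z) \<in> pole_cone \<gamma> \<sigma>"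

lemma pole_cone_scale:
  assumes "f \<in> pole_cone \<gamma> \<sigma>" "0 \<le> d"
  shows "(\<lambda>z. of_real d * f z) \<in> pole_cone \<gamma> \<sigma>"
  using assms(1)
proof induction
  case (const c)
  then show ?case
    using pole_cone.const[of "d * c" \<gamma> \<sigma>] assms(2) by simp
next
  case (pole c t)
  then show ?case
    using pole_cone.pole[of "d * c" \<gamma> t \<sigma>] assms(2) by (simp add: mult.assoc)
next
  case (add f g)
  then show ?case
    using pole_cone.add[OF add.IH] by (simp add: algebra_simps)
qed

lemma pole_cone_sum:
  assumes "finite I" "\<And>i. i \<in> I \<Longrightarrow> f i \<in> pole_cone \<gamma> \<sigma>"
  shows "(\<lambda>z. \<Sum>i\<in>I. f i z) \<in> pole_cone \<gamma> \<sigma>"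
  using assms
proof (induction I)
  case empty
  show ?case
    using pole_cone.const[of 0 \<gamma> \<sigma>] by simp
next
  case (insert i I)
  then show ?case
    using pole_cone.add[of "f i" \<gamma> \<sigma> "\<lambda>z. \<Sum>i\<in>I. f i z"] by simp
qed

lemma open_Re_gt: "open {z. c < Re z}"
  by (simp add: open_halfspace_Re_gt)

lemma shift_not_nonpos_Reals: "- t < Re z \<Longrightarrow> z + of_real t \<notin> \<real>\<^sub>\<le>\<^sub>0"
  by (auto simp: complex_nonpos_Reals_iff)

lemma pole_cone_holomorphic:
  assumes "f \<in> pole_cone \<gamma> \<sigma>"
  shows "f holomorphic_on {z. - \<gamma> < Re z}"
  using assms by induction (auto intro!: holomorphic_intros shift_not_nonpos_Reals)

lemma Re_real_powr:
  assumes "0 < y"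
  shows "Re (of_real y powr (- of_real \<sigma>)) = y powr (- \<sigma>)"
proof -
  have "of_real y powr (- complex_of_real \<sigma>) = of_real (y powr (- \<sigma>))"
    using assms powr_of_real[of y "- \<sigma>"] by simp
  then show ?thesis by simp
qed

lemma higher_deriv_shift_powr:
  assumes "- t < Re z"
  shows "(deriv ^^ k) (\<lambda>z. of_real c * (z + of_real t) powr (- of_real \<sigma>)) z =
    of_real ((-1) ^ k * c * pochhammer \<sigma> k) * (z + of_real t) powr (- of_real (\<sigma> + k))"
  using assms
proof (induction k arbitrary: z)
  case 0
  then show ?case by simp
next
  case (Suc k)
  let ?F = "\<lambda>z. complex_of_real ((-1) ^ k * c * pochhammer \<sigma> k) * (z + of_real t) powr (- of_real (\<sigma> + k))"
  have exponent: "- complex_of_real (\<sigma> + real k) - 1 = - of_real (\<sigma> + real (Suc k))"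
    by simp
  have coeff: "of_real ((-1) ^ k * c * pochhammer \<sigma> k) *
      ((- of_real (\<sigma> + k)) * (z + of_real t) powr (- of_real (\<sigma> + k) - 1) * (1 + 0)) =
      of_real ((-1) ^ Suc k * c * pochhammer \<sigma> (Suc k)) *
      (z + of_real t) powr (- of_real (\<sigma> + real (Suc k)))"
    unfolding exponent by (simp add: pochhammer_Suc algebra_simps)
  have "((\<lambda>z. (z + of_real t) powr (- of_real (\<sigma> + k))) has_field_derivative
      (- of_real (\<sigma> + k)) * (z + of_real t) powr (- of_real (\<sigma> + k) - 1) * (1 + 0)) (at z)"
    by (intro DERIV_chain2[OF has_field_derivative_powr] DERIV_add DERIV_ident DERIV_const
          shift_not_nonpos_Reals Suc.prems)
  then have "(?F has_field_derivative of_real ((-1) ^ k * c * pochhammer \<sigma> k) *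
      ((- of_real (\<sigma> + k)) * (z + of_real t) powr (- of_real (\<sigma> + k) - 1) * (1 + 0))) (at z)"
    by (rule DERIV_cmult)
  then have "(?F has_field_derivative of_real ((-1) ^ Suc k * c * pochhammer \<sigma> (Suc k)) *
      (z + of_real t) powr (- of_real (\<sigma> + real (Suc k)))) (at z)"
    unfolding coeff .
  then have "((deriv ^^ k) (\<lambda>z. of_real c * (z + of_real t) powr (- of_real \<sigma>))
      has_field_derivative of_real ((-1) ^ Suc k * c * pochhammer \<sigma> (Suc k)) *
      (z + of_real t) powr (- of_real (\<sigma> + real (Suc k)))) (at z)"
    \<comment> \<open>The induction hypothesis holds on an open half-plane, so the derivative of the
      closed form is that of the iterated derivative.\<close>
    by (rule has_field_derivative_transform_within_open[of _ _ _ "{z. - t < Re z}"])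
      (use Suc in \<open>auto simp: open_Re_gt\<close>)
  then show ?case
    by (simp add: DERIV_imp_deriv)
qed

text \<open>For a shifted power the signed derivative is its value times
  \<open>pochhammer \<sigma> k / (x + t) ^ k\<close>, and \<open>x + t \<ge> \<gamma>\<close>. Both
  inequalities are linear in \<open>f\<close>, hence survive sums.\<close>

lemma pole_cone_higher_deriv_bounds:
  assumes "f \<in> pole_cone \<gamma> \<sigma>" "0 < \<gamma>" "0 < \<sigma>" "0 \<le> x"
  shows "0 \<le> (-1) ^ k * Re ((deriv ^^ k) f (of_real x)) \<and>
    (-1) ^ k * Re ((deriv ^^ k) f (of_real x)) \<le> pochhammer \<sigma> k / \<gamma> ^ k * Re (f (of_real x))"
  using assms(1)
proof induction
  case (const c)
  then show ?case
    using assms by (cases k) (auto simp: higher_deriv_const intro!: mult_nonneg_nonneg divide_nonneg_nonneg pochhammer_nonneg)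
next
  case (pole c t)
  have x: "0 < x + t"
    using assms pole by simp
  define P where "P = pochhammer \<sigma> k"
  have P: "0 \<le> P"
    unfolding P_def using assms pochhammer_nonneg[of \<sigma> k] by simp
  have "Re ((deriv ^^ k) (\<lambda>z. of_real c * (z + of_real t) powr (- of_real \<sigma>)) (of_real x)) =
      (-1) ^ k * c * P * (x + t) powr (- (\<sigma> + k))"
    using higher_deriv_shift_powr[of t "of_real x" k c \<sigma>] x Re_real_powr[of "x + t" "\<sigma> + k"]
    by (simp add: P_def)
  then have eq: "(-1) ^ k * Re ((deriv ^^ k) (\<lambda>z. of_real c * (z + of_real t) powr (- of_real \<sigma>)) (of_real x)) =
      c * P * (x + t) powr (- (\<sigma> + k))"
    by (simp flip: power_mult_distrib mult.assoc)
  have val: "Re (of_real c * (of_real x + of_real t) powr (- of_real \<sigma>)) = c * (x + t) powr (- \<sigma>)"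
    using Re_real_powr[of "x + t" \<sigma>] x by simp
  have "(x + t) powr (- (\<sigma> + k)) = (x + t) powr (- \<sigma>) / (x + t) ^ k"
    using x by (simp add: powr_diff powr_realpow)
  also have "\<dots> \<le> (x + t) powr (- \<sigma>) / \<gamma> ^ k"
    using assms pole by (intro divide_left_mono power_mono mult_pos_pos) auto
  finally have "c * P * (x + t) powr (- (\<sigma> + k)) \<le> c * P * ((x + t) powr (- \<sigma>) / \<gamma> ^ k)"
    using pole P by (intro mult_left_mono) auto
  then show ?case
    using pole P unfolding eq val by (simp add: P_def mult_ac)
next
  case (add f g)
  have "(deriv ^^ k) (\<lambda>z. f z + g z) (of_real x) =
      (deriv ^^ k) f (of_real x) + (deriv ^^ k) g (of_real x)"
    using assms add.hyps
    by (intro higher_deriv_add[of _ "{z. - \<gamma> < Re z}"] pole_cone_holomorphic open_Re_gt) auto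
  then show ?case
    using add.IH by (simp add: algebra_simps)
qed

text \<open>\<open>\<delta>\<close> measures the relative distance to the singularity
  \<open>- t\<close>: the hypothesis on \<open>Re z\<close> yields
  \<open>Re (z + t) \<ge> \<delta> * t\<close> for all \<open>t \<ge> \<gamma>\<close> at once.
  Small \<open>\<delta>\<close> serves Montel's theorem; \<open>\<delta> = 1\<close> shows that the
  value at 0 dominates on the nonnegative axis.\<close>

lemma pole_cone_norm_le:
  assumes "f \<in> pole_cone \<gamma> \<sigma>" "0 < \<gamma>" "0 < \<sigma>" "0 < \<delta>" "\<delta> \<le> 1" "\<gamma> * (\<delta> - 1) \<le> Re z"
  shows "norm (f z) \<le> \<delta> powr (- \<sigma>) * Re (f 0)"
  using assms(1)
proof induction
  case (const c)
  have "1 \<le> \<delta> powr (- \<sigma>)"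
    using assms powr_mono2'[of "- \<sigma>" \<delta> 1] by simp
  then show ?case
    using mult_right_mono[of 1 "\<delta> powr (- \<sigma>)" c] const by simp
next
  case (pole c t)
  have t: "0 < t"
    using pole assms by simp
  have "\<delta> * t \<le> norm (z + of_real t)"
  proof -
    have "t * (\<delta> - 1) \<le> \<gamma> * (\<delta> - 1)"
      using pole assms by (intro mult_right_mono_neg) auto
    then have "\<delta> * t \<le> Re (z + of_real t)"
      using assms by (simp add: algebra_simps)
    then show ?thesis
      using complex_Re_le_cmod order_trans by blast
  qed
  then have "norm (z + of_real t) powr (- \<sigma>) \<le> (\<delta> * t) powr (- \<sigma>)"
    using assms t by (intro powr_mono2') auto
  also have "\<dots> = \<delta> powr (- \<sigma>) * t powr (- \<sigma>)"
    using assms t by (simp add: powr_mult)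
  finally have "c * norm (z + of_real t) powr (- \<sigma>) \<le> c * (\<delta> powr (- \<sigma>) * t powr (- \<sigma>))"
    using pole by (intro mult_left_mono) auto
  moreover have "norm ((z + of_real t) powr (- of_real \<sigma>)) = norm (z + of_real t) powr (- \<sigma>)"
    by (subst norm_powr_real_powr') auto
  ultimately show ?case
    using Re_real_powr[OF t, of \<sigma>] pole by (simp add: norm_mult mult_ac)
next
  case (add f g)
  then show ?case
    using norm_triangle_ineq[of "f z" "g z"] by (simp add: algebra_simps)
qed

text \<open>A Harnack-type counterpart of the upper bound: \<open>t \<ge> 1\<close> gives
  \<open>x + t \<le> (1 + a) * t\<close>, so the constant is independent of
  \<open>t\<close>.\<close>

lemma pole_cone_ge:
  assumes "f \<in> pole_cone \<gamma> \<sigma>" "1 \<le> \<gamma>" "0 < \<sigma>" "0 \<le> x" "x \<le> a"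
  shows "(1 + a) powr (- \<sigma>) * Re (f 0) \<le> Re (f (of_real x))"
  using assms(1)
proof induction
  case (const c)
  have "(1 + a) powr (- \<sigma>) \<le> 1"
    using assms powr_mono2'[of "- \<sigma>" 1 "1 + a"] by simp
  then show ?case
    using mult_right_mono[of "(1 + a) powr (- \<sigma>)" 1 c] const by simp
next
  case (pole c t)
  have t: "1 \<le> t"
    using pole assms by simp
  have "a * 1 \<le> a * t"
    using t assms by (intro mult_left_mono) auto
  then have "x + t \<le> (1 + a) * t"
    using assms by (simp add: algebra_simps)
  then have "((1 + a) * t) powr (- \<sigma>) \<le> (x + t) powr (- \<sigma>)"
    using assms t by (intro powr_mono2') auto
  then have "(1 + a) powr (- \<sigma>) * t powr (- \<sigma>) \<le> (x + t) powr (- \<sigma>)"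
    using assms t by (simp add: powr_mult)
  then have "c * ((1 + a) powr (- \<sigma>) * t powr (- \<sigma>)) \<le> c * (x + t) powr (- \<sigma>)"
    using pole by (intro mult_left_mono) auto
  then show ?case
    using Re_real_powr[of t \<sigma>] Re_real_powr[of "x + t" \<sigma>] t assms by (simp add: mult_ac)
next
  case (add f g)
  then show ?case by (simp add: algebra_simps)
qed

section \<open>Action of the operator on the cone\<close>

lemma Lambda_op_add:
  "Lambda_op s B (\<lambda>x. f x + g x) x = Lambda_op s B f x + Lambda_op s B g x"
  by (simp add: Lambda_op_def algebra_simps sum.distrib)

lemma Lambda_op_scale: "Lambda_op s B (\<lambda>x. c * f x) x = c * Lambda_op s B f x"
  by (simp add: Lambda_op_def sum_distrib_left mult_ac)

text \<open>\<open>Lambda_op\<close> acts on real functions while the cone consists of complex ones,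
  so the image is represented by a cone element agreeing with it on the nonnegative axis. A constant
  goes to shifted powers with parameters \<open>\<beta>\<close>; a shifted power with parameter
  \<open>t\<close> goes to those with parameters \<open>\<beta> + 1 / t\<close>, weighted by
  \<open>t powr (- (2 * s))\<close>.\<close>

lemma Lambda_op_pole_cone:
  assumes "f \<in> pole_cone \<gamma> (2 * s)" "0 < \<gamma>" "finite B" "\<forall>\<beta>\<in>B. \<gamma> \<le> \<beta>"
  shows "\<exists>g\<in>pole_cone \<gamma> (2 * s). \<forall>x\<ge>0.
    Re (g (of_real x)) = Lambda_op s B (\<lambda>y. Re (f (of_real y))) x"
  using assms(1)
proof induction
  case (const c)
  have "Re (\<Sum>\<beta>\<in>B. of_real c * (of_real x + of_real \<beta>) powr (- of_real (2 * s))) =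
      Lambda_op s B (\<lambda>y. Re (of_real c)) x" if "0 \<le> x" for x
  proof -
    have "Re ((of_real x + of_real \<beta>) powr (- of_real (2 * s))) = (x + \<beta>) powr (- (2 * s))"
      if "\<beta> \<in> B" for \<beta>
      using Re_real_powr[of "x + \<beta>" "2 * s"] assms that \<open>0 \<le> x\<close> by fastforce
    then show ?thesis
      by (simp add: Lambda_op_def mult_ac)
  qed
  moreover have "(\<lambda>z. \<Sum>\<beta>\<in>B. of_real c * (z + of_real \<beta>) powr (- of_real (2 * s)))
      \<in> pole_cone \<gamma> (2 * s)"
    using assms const by (intro pole_cone_sum pole_cone.pole) auto
  ultimately show ?case
    by (intro bexI[of _ "\<lambda>z. \<Sum>\<beta>\<in>B. of_real c * (z + of_real \<beta>) powr (- of_real (2 * s))"] allI impI)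
next
  case (pole c t)
  have t: "0 < t"
    using pole assms by simp
  have "Re (\<Sum>\<beta>\<in>B. of_real (c * t powr (- (2 * s))) *
        (of_real x + of_real (\<beta> + 1 / t)) powr (- of_real (2 * s))) =
      Lambda_op s B (\<lambda>y. Re (of_real c * (of_real y + of_real t) powr (- of_real (2 * s)))) x"
    if "0 \<le> x" for x
  proof -
    have "Re (of_real (c * t powr (- (2 * s))) *
        (of_real x + of_real (\<beta> + 1 / t)) powr (- of_real (2 * s))) =
      (x + \<beta>) powr (- 2 * s) *
        Re (of_real c * (of_real (1 / (x + \<beta>)) + of_real t) powr (- of_real (2 * s)))"
      if "\<beta> \<in> B" for \<beta>
    proof -
      have x: "0 < x + \<beta>"
        using assms that \<open>0 \<le> x\<close> by fastforce
      then have "t * (x + (\<beta> + 1 / t)) = (x + \<beta>) * (1 / (x + \<beta>) + t)"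
        using t by (simp add: field_simps)
      moreover have left: "0 < x + (\<beta> + 1 / t)"
        using x t by (simp flip: add.assoc add: add_pos_pos)
      moreover have right: "0 < 1 / (x + \<beta>) + t"
        using x t by (simp add: add_pos_pos)
      moreover from left right have "(t * (x + (\<beta> + 1 / t))) powr (- (2 * s)) =
          t powr (- (2 * s)) * (x + (\<beta> + 1 / t)) powr (- (2 * s))"
        "((x + \<beta>) * (1 / (x + \<beta>) + t)) powr (- (2 * s)) =
          (x + \<beta>) powr (- (2 * s)) * (1 / (x + \<beta>) + t) powr (- (2 * s))"
        using x t by (intro powr_mult; simp)+
      ultimately have scalar: "t powr (- (2 * s)) * (x + (\<beta> + 1 / t)) powr (- (2 * s)) =
          (x + \<beta>) powr (- (2 * s)) * (1 / (x + \<beta>) + t) powr (- (2 * s))"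
        by simp
      have Re_left: "Re ((of_real x + of_real (\<beta> + 1 / t)) powr (- of_real (2 * s))) =
          (x + (\<beta> + 1 / t)) powr (- (2 * s))"
        using Re_real_powr[OF left] by (simp only: of_real_add)
      have Re_right: "Re ((of_real (1 / (x + \<beta>)) + of_real t) powr (- of_real (2 * s))) =
          (1 / (x + \<beta>) + t) powr (- (2 * s))"
        using Re_real_powr[OF right] by (simp only: of_real_add)
      have Re_scale: "Re (of_real r * w) = r * Re w" for r w
        by simp
      have "c * (t powr (- (2 * s)) * (x + (\<beta> + 1 / t)) powr (- (2 * s))) =
          c * ((x + \<beta>) powr (- (2 * s)) * (1 / (x + \<beta>) + t) powr (- (2 * s)))"
        by (simp only: scalar)
      then show ?thesis
        unfolding Re_scale Re_left Re_right by (simp add: mult_ac)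
    qed
    then show ?thesis
      unfolding Lambda_op_def Re_sum by (intro sum.cong refl)
  qed
  moreover have "(\<lambda>z. \<Sum>\<beta>\<in>B. of_real (c * t powr (- (2 * s))) *
        (z + of_real (\<beta> + 1 / t)) powr (- of_real (2 * s))) \<in> pole_cone \<gamma> (2 * s)"
    using assms pole t by (intro pole_cone_sum pole_cone.pole) (auto intro!: add_increasing2)
  ultimately show ?case
    by (intro bexI[of _ "\<lambda>z. \<Sum>\<beta>\<in>B. of_real (c * t powr (- (2 * s))) *
      (z + of_real (\<beta> + 1 / t)) powr (- of_real (2 * s))"] allI impI)
next
  case (add f g)
  then obtain f' g' where "f' \<in> pole_cone \<gamma> (2 * s)" "g' \<in> pole_cone \<gamma> (2 * s)"
    "\<forall>x\<ge>0. Re (f' (of_real x)) = Lambda_op s B (\<lambda>y. Re (f (of_real y))) x"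
    "\<forall>x\<ge>0. Re (g' (of_real x)) = Lambda_op s B (\<lambda>y. Re (g (of_real y))) x"
    by blast
  then show ?case
    by (intro bexI[of _ "\<lambda>z. f' z + g' z"] pole_cone.add) (auto simp: Lambda_op_add)
qed

section \<open>From holomorphic functions to real functions on the closed interval\<close>

text \<open>The two claims go through one induction: differentiability at level \<open>k\<close>
  supplies the formula at level \<open>k + 1\<close> on a whole neighbourhood, which is then
  differentiated again.\<close>

lemma deriv_funpow_Re_of_real:
  assumes "g holomorphic_on {z. c < Re z}" "c < x"
  shows "(deriv ^^ k) (\<lambda>x. Re (g (of_real x))) x = Re ((deriv ^^ k) g (of_real x)) \<and>
    ((deriv ^^ k) (\<lambda>x. Re (g (of_real x))) has_real_derivative
      Re ((deriv ^^ Suc k) g (of_real x))) (at x)"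
  using assms(2)
proof (induction k arbitrary: x)
  have Re_deriv: "((\<lambda>x. Re ((deriv ^^ k) g (of_real x))) has_real_derivative
      Re ((deriv ^^ Suc k) g (of_real x))) (at x)" if "c < x" for x k
  proof -
    have "((deriv ^^ k) g has_field_derivative (deriv ^^ Suc k) g (of_real x)) (at (of_real x))"
      using assms(1) that holomorphic_derivI[OF holomorphic_higher_deriv open_Re_gt]
      by (simp add: open_Re_gt)
    then have "((\<lambda>x. (deriv ^^ k) g (of_real x)) has_vector_derivative (deriv ^^ Suc k) g (of_real x)) (at x)"
      by (rule has_vector_derivative_real_field)
    then show ?thesis
      unfolding has_real_derivative_iff_has_vector_derivative
      by (rule bounded_linear.has_vector_derivative[OF bounded_linear_Re])
  qed
  {
    case 0
    then show ?case using Re_deriv[of x 0] by simp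
  next
    case (Suc k)
    have eq: "(deriv ^^ Suc k) (\<lambda>x. Re (g (of_real x))) y = Re ((deriv ^^ Suc k) g (of_real y))"
      if "c < y" for y
      using Suc.IH[OF that] by (simp add: DERIV_imp_deriv)
    have "((deriv ^^ Suc k) (\<lambda>x. Re (g (of_real x))) has_real_derivative
      Re ((deriv ^^ Suc (Suc k)) g (of_real x))) (at x)"
      by (rule has_field_derivative_transform_within_open[OF Re_deriv[OF Suc.prems], of "{c<..}"])
        (use Suc.prems eq in auto)
    with eq[OF Suc.prems] show ?case by blast
  }
qed

text \<open>As \<open>c < 0\<close>, the closed interval lies inside the domain of holomorphy. The
  real derivatives are therefore continuous at both endpoints, and the limits in \<open>Dbar\<close>
  are ordinary values.\<close>

lemma
  assumes "g holomorphic_on {z. c < Re z}" "c < 0" "0 < a"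
  shows Cm_bar_Re_of_real: "Cm_bar k a (\<lambda>x. Re (g (of_real x)))"
    and Dbar_Re_of_real: "x \<in> {0..a} \<Longrightarrow>
      Dbar a k (\<lambda>x. Re (g (of_real x))) x = Re ((deriv ^^ k) g (of_real x))"
proof -
  let ?v = "\<lambda>x. Re (g (of_real x))"
  note D = deriv_funpow_Re_of_real[OF assms(1)]
  have cont: "continuous_on {0..a} ((deriv ^^ k) ?v)" for k
    using D[THEN conjunct2, THEN DERIV_isCont] assms(2)
    by (intro continuous_at_imp_continuous_on) auto
  have "(deriv ^^ k) ?v differentiable (at x)" if "0 < x" for k x
    using D[of x k] that assms(2) by (auto simp: real_differentiable_def)
  then show "Cm_bar k a ?v"
    using cont[of 0] cont by (auto simp: Cm_bar_def)
  assume x: "x \<in> {0..a}"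
  show "Dbar a k ?v x = Re ((deriv ^^ k) g (of_real x))"
  proof -
    have "((deriv ^^ k) ?v \<longlongrightarrow> (deriv ^^ k) ?v x) (at x within {0..a})"
      using cont[of k] x unfolding continuous_on by blast
    then have "((deriv ^^ k) ?v \<longlongrightarrow> (deriv ^^ k) ?v x) (at x within {0<..<a})"
      by (rule tendsto_within_subset) (rule greaterThanLessThan_subseteq_atLeastAtMost_iff[THEN iffD2], simp)
    \<comment> \<open>\<open>Lim\<close> is determined only at accumulation points of the open
      interval; the endpoints are such points too.\<close>
    moreover have "x islimpt {0<..<a}"
    proof (cases "x \<in> {0<..<a}")
      case True
      then show ?thesis by (simp add: interior_limit_point interior_open)
    next
      case False
      with x have "x = 0 \<or> x = a" by auto
      then show ?thesis
        using islimpt_greaterThanLessThan1[OF assms(3)] islimpt_greaterThanLessThan2[OF assms(3)] by blast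
    qed
    then have "at x within {0<..<a} \<noteq> bot"
      by (simp add: trivial_limit_within)
    ultimately have "Lim (at x within {0<..<a}) ((deriv ^^ k) ?v) = (deriv ^^ k) ?v x"
      using tendsto_Lim by blast
    then show ?thesis
      using D[of x k] x assms(2) by (auto simp: Dbar_def)
  qed
qed

section \<open>Positivity of the operator and growth of the iterates of 1\<close>

locale gauss_type_operator =
  fixes \<gamma> a s :: real and B :: "real set"
  assumes gamma: "1 \<le> \<gamma>" and finite_B: "finite B" and nonempty_B: "B \<noteq> {}"
    and B_ge: "\<forall>\<beta>\<in>B. \<gamma> \<le> \<beta>" and gamma_le: "\<gamma> \<le> a" and s_pos: "0 < s"
begin

abbreviation \<Lambda> :: "(real \<Rightarrow> real) \<Rightarrow> real \<Rightarrow> real" where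
  "\<Lambda> \<equiv> Lambda_op s B"

abbreviation u :: "nat \<Rightarrow> real \<Rightarrow> real" where
  "u n \<equiv> (\<Lambda> ^^ n) (\<lambda>_. 1)"

text \<open>The constant of \<open>pole_cone_ge\<close> for exponent \<open>2 * s\<close>: on
  \<open>{0..a}\<close> every iterate \<open>u n\<close> varies by at most the factor
  \<open>1 / \<kappa>\<close>, uniformly in \<open>n\<close>.\<close>

definition \<kappa> :: real where
  "\<kappa> = (1 + a) powr (- (2 * s))"

lemma kappa_pos: "0 < \<kappa>"
  using gamma gamma_le by (simp add: \<kappa>_def)

text \<open>Since \<open>x + \<beta> \<ge> 1\<close>, the branch value is in the unit interval, and
  \<open>1 \<le> \<gamma> \<le> a\<close>. Hence \<open>\<Lambda> f\<close> on the whole nonnegative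
  axis depends only on \<open>f\<close> on \<open>{0..a}\<close>.\<close>

lemma branch_in:
  assumes "\<beta> \<in> B" "0 \<le> x"
  shows "1 / (x + \<beta>) \<in> {0..a}"
proof -
  have "1 \<le> x + \<beta>"
    using assms B_ge gamma by (smt (verit))
  then have "0 \<le> 1 / (x + \<beta>)" "1 / (x + \<beta>) \<le> 1"
    by simp_all
  moreover have "1 \<le> a"
    using gamma gamma_le by simp
  ultimately show ?thesis
    unfolding atLeastAtMost_iff by linarith
qed

lemma weight_pos:
  assumes "\<beta> \<in> B" "0 \<le> x"
  shows "0 < (x + \<beta>) powr (- 2 * s)"
proof -
  have "1 \<le> x + \<beta>"
    using assms B_ge gamma by (smt (verit))
  then show ?thesis by simp
qed

lemma Lambda_mono:
  assumes "\<And>y. y \<in> {0..a} \<Longrightarrow> f y \<le> g y" "0 \<le> x"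
  shows "\<Lambda> f x \<le> \<Lambda> g x"
  unfolding Lambda_op_def
  using assms branch_in by (intro sum_mono mult_left_mono) auto

lemma Lambda_cong:
  assumes "\<And>y. y \<in> {0..a} \<Longrightarrow> f y = g y" "0 \<le> x"
  shows "\<Lambda> f x = \<Lambda> g x"
  unfolding Lambda_op_def
  using assms branch_in by (intro sum.cong) auto

lemma Lambda_pos:
  assumes "\<And>y. y \<in> {0..a} \<Longrightarrow> 0 < f y" "0 \<le> x"
  shows "0 < \<Lambda> f x"
  unfolding Lambda_op_def
  using assms branch_in weight_pos finite_B nonempty_B by (intro sum_pos mult_pos_pos) auto

lemma Lambda_funpow_mono:
  assumes "\<And>y. y \<in> {0..a} \<Longrightarrow> f y \<le> g y" "x \<in> {0..a}"
  shows "(\<Lambda> ^^ n) f x \<le> (\<Lambda> ^^ n) g x"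
  using assms(2) by (induction n arbitrary: x) (auto intro!: assms(1) Lambda_mono)

lemma Lambda_funpow_scale: "(\<Lambda> ^^ n) (\<lambda>x. c * f x) = (\<lambda>x. c * (\<Lambda> ^^ n) f x)"
  by (induction n) (auto simp: Lambda_op_scale)

lemma Lambda_funpow_eigen:
  assumes "\<And>y. y \<in> {0..a} \<Longrightarrow> \<Lambda> v y = lam * v y" "x \<in> {0..a}"
  shows "(\<Lambda> ^^ n) v x = lam ^ n * v x"
  using assms(2)
proof (induction n arbitrary: x)
  case (Suc n)
  have "\<Lambda> ((\<Lambda> ^^ n) v) x = \<Lambda> (\<lambda>y. lam ^ n * v y) x"
    using Suc by (intro Lambda_cong) auto
  then show ?case
    using assms(1)[OF Suc.prems] by (simp add: Lambda_op_scale)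
qed auto

lemma u_pole_cone: "\<exists>f\<in>pole_cone \<gamma> (2 * s). \<forall>x\<ge>0. Re (f (of_real x)) = u n x"
proof (induction n)
  case 0
  show ?case
    using pole_cone.const[of 1 \<gamma> "2 * s"] by (intro bexI[of _ "\<lambda>_. of_real 1"]) auto
next
  case (Suc n)
  then obtain f where f: "f \<in> pole_cone \<gamma> (2 * s)" "\<And>x. 0 \<le> x \<Longrightarrow> Re (f (of_real x)) = u n x"
    by blast
  obtain g where g: "g \<in> pole_cone \<gamma> (2 * s)"
    "\<And>x. 0 \<le> x \<Longrightarrow> Re (g (of_real x)) = \<Lambda> (\<lambda>y. Re (f (of_real y))) x"
    using Lambda_op_pole_cone[OF f(1) _ finite_B B_ge] gamma by (meson less_le_trans zero_less_one)
  have "Re (g (of_real x)) = u (Suc n) x" if "0 \<le> x" for x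
    unfolding g(2)[OF that] using f(2) that by (auto intro!: Lambda_cong)
  with g(1) show ?case by blast
qed

lemma u_pos: "0 \<le> x \<Longrightarrow> 0 < u n x"
  by (induction n arbitrary: x) (auto intro!: Lambda_pos)

lemma u_bounds:
  assumes "x \<in> {0..a}"
  shows "\<kappa> * u n 0 \<le> u n x" "u n x \<le> u n 0"
proof -
  obtain f where f: "f \<in> pole_cone \<gamma> (2 * s)" "\<And>x. 0 \<le> x \<Longrightarrow> Re (f (of_real x)) = u n x"
    using u_pole_cone by blast
  show "\<kappa> * u n 0 \<le> u n x"
    using pole_cone_ge[OF f(1) gamma, of x a] assms s_pos f(2)[of 0] f(2)[of x] by (simp add: \<kappa>_def)
  have "Re (f (of_real x)) \<le> norm (f (of_real x))"
    by (rule complex_Re_le_cmod)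
  also have "\<dots> \<le> Re (f 0)"
    using pole_cone_norm_le[OF f(1), of 1 "of_real x"] assms s_pos gamma by simp
  finally show "u n x \<le> u n 0"
    using f(2)[of 0] f(2)[of x] assms by simp
qed

text \<open>By \<open>u_bounds\<close>, \<open>u n\<close> lies below the constant
  \<open>u n 0\<close>; monotonicity and homogeneity of the \<open>m\<close>-th iterate give the
  product bound. The reverse bound below uses the constant \<open>\<kappa> * u n 0\<close>
  instead.\<close>

lemma u_submultiplicative: "u (m + n) 0 \<le> u n 0 * u m 0"
proof -
  have "(\<Lambda> ^^ m) (u n) 0 \<le> (\<Lambda> ^^ m) (\<lambda>_. u n 0 * 1) 0"
    using u_bounds gamma gamma_le by (intro Lambda_funpow_mono) auto
  also have "\<dots> = u n 0 * u m 0"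
    by (subst Lambda_funpow_scale) (rule refl)
  finally show ?thesis by (simp add: funpow_add)
qed

lemma u_supermultiplicative: "\<kappa> * u n 0 * u m 0 \<le> u (m + n) 0"
proof -
  have "\<kappa> * u n 0 * u m 0 = (\<Lambda> ^^ m) (\<lambda>_. \<kappa> * u n 0 * 1) 0"
    by (subst Lambda_funpow_scale) (rule refl)
  also have "\<dots> \<le> (\<Lambda> ^^ m) (u n) 0"
    using u_bounds gamma gamma_le by (intro Lambda_funpow_mono) auto
  finally show ?thesis by (simp add: funpow_add)
qed

lemma u_mult_le: "u (k * n) 0 \<le> u n 0 ^ k"
proof (induction k)
  case (Suc k)
  have "u (Suc k * n) 0 \<le> u (k * n) 0 * u n 0"
    using u_submultiplicative[of n "k * n"] by (simp add: mult.commute)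
  also have "\<dots> \<le> u n 0 ^ k * u n 0"
    using Suc u_pos[of 0 n] by (intro mult_right_mono) auto
  finally show ?case by (simp add: mult.commute)
qed auto

text \<open>Iterates the supermultiplicativity of \<open>\<kappa> * u n 0\<close>. At
  \<open>k = 0\<close> the inequality would read \<open>1 \<le> \<kappa>\<close>, so the induction
  effectively starts at \<open>k = 1\<close>.\<close>

lemma u_mult_ge: "0 < k \<Longrightarrow> (\<kappa> * u n 0) ^ k \<le> \<kappa> * u (k * n) 0"
proof (induction k)
  case (Suc k)
  show ?case
  proof (cases "k = 0")
    case False
    then have "(\<kappa> * u n 0) ^ Suc k \<le> (\<kappa> * u n 0) * (\<kappa> * u (k * n) 0)"
      using Suc u_pos[of 0 n] kappa_pos by (simp add: mult_left_mono)
    also have "\<dots> \<le> \<kappa> * u (Suc k * n) 0"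
      using u_supermultiplicative[of "k * n" n] kappa_pos by (simp add: mult_ac)
    finally show ?thesis by simp
  qed auto
qed auto

text \<open>
The rate is \<open>sup (\<kappa> u\<^sub>n(0))\<close> to the power \<open>1/n\<close>: as \<open>u\<^sub>n(0)\<close> is submultiplicative and
\<open>\<kappa> u\<^sub>n(0)\<close> supermultiplicative, each term of this supremum is at most each \<open>n\<close>-th root of
\<open>u\<^sub>n(0)\<close>.
\<close>

lemma growth_rate: "\<exists>r>0. \<forall>n. \<kappa> * u n 0 \<le> r ^ n \<and> r ^ n \<le> u n 0"
proof -
  have kappa_le: "\<kappa> \<le> 1"
    using u_bounds(1)[of 0 0] gamma gamma_le by simp
  define R where "R = (\<lambda>n. root n (\<kappa> * u n 0)) ` {0<..}"
  have root_le: "root n (\<kappa> * u n 0) \<le> root m (u m 0)" if "0 < n" "0 < m" for m n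
  proof -
    \<comment> \<open>The two roots are compared through the iterate with common index
      \<open>n * m\<close>.\<close>
    have "(\<kappa> * u n 0) ^ m \<le> \<kappa> * u (m * n) 0"
      using u_mult_ge[of m n] that by simp
    also have "\<dots> \<le> u (n * m) 0"
      using u_pos[of 0 "n * m"] kappa_le by (simp add: mult.commute)
    also have "\<dots> \<le> u m 0 ^ n"
      by (rule u_mult_le)
    finally have "root (n * m) ((\<kappa> * u n 0) ^ m) \<le> root (n * m) (u m 0 ^ n)"
      using that by simp
    then show ?thesis
      using that u_pos[of 0] kappa_pos
      by (simp add: real_root_mult_exp real_root_power_cancel less_imp_le real_root_power mult.commute)
  qed
  have bdd: "bdd_above R"
    unfolding R_def using root_le[of _ 1] by (intro bdd_aboveI2[of _ _ "root 1 (u 1 0)"]) auto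
  define r where "r = Sup R"
  have lower: "root n (\<kappa> * u n 0) \<le> r" if "0 < n" for n
    unfolding r_def using bdd that by (intro cSup_upper) (auto simp: R_def)
  have upper: "r \<le> root n (u n 0)" if "0 < n" for n
    unfolding r_def using that root_le by (intro cSup_least) (auto simp: R_def)
  have "0 < root 1 (\<kappa> * u 1 0)"
    using kappa_pos u_pos[of 0 1] by simp
  also have "\<dots> \<le> r"
    by (rule lower) simp
  finally have "0 < r" .
  moreover have "\<kappa> * u n 0 \<le> r ^ n \<and> r ^ n \<le> u n 0" for n
  \<comment> \<open>\<open>root 0\<close> is constantly 0 and carries no information; at
    \<open>n = 0\<close> the claim reduces to \<open>\<kappa> \<le> 1\<close>.\<close>
  proof (cases "n = 0")
    case False
    have "root n (\<kappa> * u n 0) ^ n \<le> r ^ n"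
      using lower[of n] False kappa_pos u_pos[of 0 n] by (intro power_mono) auto
    moreover have "r ^ n \<le> root n (u n 0) ^ n"
      using upper[of n] False \<open>0 < r\<close> by (intro power_mono) auto
    ultimately show ?thesis
      using False kappa_pos u_pos[of 0 n] by simp
  qed (use kappa_le in auto)
  ultimately show ?thesis by blast
qed

section \<open>Existence of the eigenfunction by normal families\<close>

lemma pole_cone_locally_bounded:
  assumes "compact K" "K \<subseteq> {z. - \<gamma> < Re z}"
  shows "\<exists>C. \<forall>f\<in>{f \<in> pole_cone \<gamma> (2 * s). Re (f 0) \<le> M}. \<forall>z\<in>K. norm (f z) \<le> C"
proof (cases "K = {}")
  case False
  then obtain z0 where z0: "z0 \<in> K" "\<And>z. z \<in> K \<Longrightarrow> Re z0 \<le> Re z"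
    using continuous_attains_inf[OF assms(1) False continuous_on_Re[OF continuous_on_id]] by blast
  \<comment> \<open>The largest \<open>\<delta> \<le> 1\<close> with
    \<open>\<gamma> * (\<delta> - 1) \<le> Re z0\<close>, where \<open>z0\<close> is a leftmost
    point of \<open>K\<close>; it is positive because \<open>- \<gamma> < Re z0\<close>.\<close>
  define \<delta> where "\<delta> = min 1 ((Re z0 + \<gamma>) / \<gamma>)"
  have \<delta>: "0 < \<delta>" "\<delta> \<le> 1"
    using z0(1) assms(2) gamma by (auto simp: \<delta>_def)
  have "\<gamma> * \<delta> \<le> \<gamma> * ((Re z0 + \<gamma>) / \<gamma>)"
    using gamma by (intro mult_left_mono) (auto simp: \<delta>_def)
  then have "\<gamma> * (\<delta> - 1) \<le> Re z0"
    using gamma by (simp add: right_diff_distrib)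
  then have "norm (f z) \<le> \<delta> powr (- (2 * s)) * M"
    if "f \<in> pole_cone \<gamma> (2 * s)" "Re (f 0) \<le> M" "z \<in> K" for f z
    using pole_cone_norm_le[OF that(1) _ _ \<delta>, of z] z0(2)[OF that(3)] gamma s_pos
      mult_left_mono[OF that(2), of "\<delta> powr (- (2 * s))"] by simp
  then show ?thesis by blast
qed auto

theorem eigenfunction_exists:
  obtains g r where "g holomorphic_on {z. - \<gamma> < Re z}"
    "\<And>x. x \<in> {0..a} \<Longrightarrow> 0 < Re (g (of_real x))"
    "\<And>x. x \<in> {0..a} \<Longrightarrow> \<Lambda> (\<lambda>y. Re (g (of_real y))) x = r * Re (g (of_real x))"
    "\<And>k x. 0 \<le> x \<Longrightarrow> 0 \<le> (-1) ^ k * Re ((deriv ^^ k) g (of_real x)) \<and>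
      (-1) ^ k * Re ((deriv ^^ k) g (of_real x)) \<le> pochhammer (2 * s) k / \<gamma> ^ k * Re (g (of_real x))"
proof -
  let ?S = "{z. - \<gamma> < Re z}"
  obtain U where U: "\<And>n. U n \<in> pole_cone \<gamma> (2 * s)"
    "\<And>n x. 0 \<le> x \<Longrightarrow> Re (U n (of_real x)) = u n x"
    using u_pole_cone by metis
  obtain r where r: "0 < r" "\<And>n. \<kappa> * u n 0 \<le> r ^ n" "\<And>n. r ^ n \<le> u n 0"
    using growth_rate by blast
  \<comment> \<open>\<open>H\<close> are the Cesaro means as holomorphic functions, for Montel's
    theorem; \<open>h\<close> are their values on the nonnegative axis, on which
    \<open>\<Lambda>\<close> acts.\<close>
  define H where "H N z = (\<Sum>n<Suc N. of_real (1 / (Suc N * r ^ n)) * U n z)" for N z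
  define h where "h N x = (\<Sum>n<Suc N. 1 / (Suc N * r ^ n) * u n x)" for N x
  have H: "H N \<in> pole_cone \<gamma> (2 * s)" for N
    unfolding H_def using r(1) U(1) by (intro pole_cone_sum pole_cone_scale) auto
  have Re_H: "Re (H N (of_real x)) = h N x" if "0 \<le> x" for N x
    using U(2)[OF that] by (simp add: H_def h_def del: sum.lessThan_Suc)
  \<comment> \<open>Both growth inequalities enter here: the scaled iterates stay between positive
    constants, so the limit function can neither vanish nor blow up on
    \<open>{0..a}\<close>.\<close>
  have ratio: "\<kappa> \<le> u n x / r ^ n" "u n x / r ^ n \<le> 1 / \<kappa>" if "x \<in> {0..a}" for n x
  proof -
    have "\<kappa> * r ^ n \<le> \<kappa> * u n 0"
      using r(3) kappa_pos by simp
    also have "\<dots> \<le> u n x"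
      using u_bounds(1)[OF that] .
    finally show "\<kappa> \<le> u n x / r ^ n"
      using r(1) by (simp add: field_simps)
    have "\<kappa> * u n x \<le> \<kappa> * u n 0"
      using u_bounds(2)[OF that] kappa_pos by simp
    also have "\<dots> \<le> r ^ n"
      by (rule r(2))
    finally show "u n x / r ^ n \<le> 1 / \<kappa>"
      using r(1) kappa_pos by (simp add: field_simps)
  qed
  have h_eq: "h N x = (\<Sum>n<Suc N. u n x / r ^ n) / Suc N" for N x
    unfolding h_def sum_divide_distrib by (intro sum.cong) auto
  have h_bounds: "\<kappa> \<le> h N x" "h N x \<le> 1 / \<kappa>" if "x \<in> {0..a}" for N x
  proof -
    have "of_nat (card {..<Suc N}) * \<kappa> \<le> (\<Sum>n<Suc N. u n x / r ^ n)"
      using ratio[OF that] by (intro sum_bounded_below)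
    then show "\<kappa> \<le> h N x"
      unfolding h_eq by (simp add: field_simps del: sum.lessThan_Suc)
    have "(\<Sum>n<Suc N. u n x / r ^ n) \<le> of_nat (card {..<Suc N}) * (1 / \<kappa>)"
      using ratio[OF that] by (intro sum_bounded_above)
    then show "h N x \<le> 1 / \<kappa>"
      unfolding h_eq by (simp add: divide_le_eq mult.commute del: sum.lessThan_Suc)
  qed
  have range_H: "range H \<subseteq> {f \<in> pole_cone \<gamma> (2 * s). Re (f 0) \<le> 1 / \<kappa>}"
    using H Re_H[of 0] h_bounds[of 0] gamma gamma_le by auto
  have holomorphic: "f holomorphic_on ?S" if "f \<in> {f \<in> pole_cone \<gamma> (2 * s). Re (f 0) \<le> 1 / \<kappa>}" for f
    using that pole_cone_holomorphic by blast
  obtain g \<rho> where g: "g holomorphic_on ?S" and \<rho>: "strict_mono (\<rho> :: nat \<Rightarrow> nat)"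
    and lim: "\<And>z. z \<in> ?S \<Longrightarrow> (\<lambda>n. H (\<rho> n) z) \<longlonglongrightarrow> g z"
    and ulim: "\<And>K. \<lbrakk>compact K; K \<subseteq> ?S\<rbrakk> \<Longrightarrow> uniform_limit K (H \<circ> \<rho>) g sequentially"
    by (rule Montel[OF open_Re_gt holomorphic pole_cone_locally_bounded range_H]) blast+
  define v where "v = (\<lambda>x. Re (g (of_real x)))"
  have lim_h: "(\<lambda>n. h (\<rho> n) x) \<longlonglongrightarrow> v x" if "0 \<le> x" for x
    using tendsto_Re[OF lim[of "of_real x"]] that gamma by (simp add: Re_H v_def)
  have "\<kappa> \<le> v x" if "x \<in> {0..a}" for x
    by (rule LIMSEQ_le_const[OF lim_h]) (use that h_bounds(1)[OF that] in auto)
  then have v_pos: "0 < v x" if "x \<in> {0..a}" for x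
    using kappa_pos that by force
  have "\<Lambda> v x = r * v x" if x: "x \<in> {0..a}" for x
  proof -
    have lim_Lambda: "(\<lambda>n. \<Lambda> (h (\<rho> n)) x) \<longlonglongrightarrow> \<Lambda> v x"
      unfolding Lambda_op_def using x branch_in
      by (intro tendsto_sum tendsto_mult tendsto_const lim_h) auto
    \<comment> \<open>\<open>\<Lambda>\<close> shifts the index of the iterates by one, so after
      scaling by \<open>r\<close> the sum telescopes and only its two end terms, divided by
      \<open>Suc N\<close>, remain as error.\<close>
    have Lambda_h: "\<Lambda> (h N) x = r * (h N x + (u (Suc N) x / r ^ Suc N - 1) / Suc N)" for N
    proof -
      have "\<Lambda> (h N) x = (\<Sum>n<Suc N. 1 / (Suc N * r ^ n) * u (Suc n) x)"
        unfolding h_def Lambda_op_def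
        by (simp add: sum_distrib_left mult_ac sum.swap[of _ B] del: sum.lessThan_Suc)
      also have "\<dots> = r * ((\<Sum>n<Suc N. u (Suc n) x / r ^ Suc n) / Suc N)"
        unfolding sum_divide_distrib sum_distrib_left using r(1) by (intro sum.cong) auto
      also have "(\<Sum>n<Suc N. u (Suc n) x / r ^ Suc n) =
          (\<Sum>n<Suc N. u n x / r ^ n) + (u (Suc N) x / r ^ Suc N - u 0 x / r ^ 0)"
        by (subst sum_lessThan_telescope[symmetric]) (simp add: sum_subtractf)
      finally show ?thesis
        unfolding h_eq by (simp add: add_divide_distrib del: sum.lessThan_Suc)
    qed
    have "(\<lambda>N. (u (Suc N) x / r ^ Suc N - 1) / Suc N) \<longlonglongrightarrow> 0"
    proof (rule Lim_null_comparison)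
      show "(\<lambda>N. (1 / \<kappa> + 1) / Suc N) \<longlonglongrightarrow> 0"
        by (intro LIMSEQ_Suc lim_const_over_n)
      show "\<forall>\<^sub>F N in sequentially. norm ((u (Suc N) x / r ^ Suc N - 1) / Suc N) \<le> (1 / \<kappa> + 1) / Suc N"
      proof (intro always_eventually allI)
        fix N
        have "\<bar>u (Suc N) x / r ^ Suc N - 1\<bar> \<le> 1 / \<kappa> + 1"
          using ratio[OF x, of "Suc N"] kappa_pos by (simp only: abs_le_iff) linarith
        then show "norm ((u (Suc N) x / r ^ Suc N - 1) / Suc N) \<le> (1 / \<kappa> + 1) / Suc N"
          by (simp only: real_norm_def abs_divide abs_of_nat) (rule divide_right_mono, auto)
      qed
    qed
    from LIMSEQ_subseq_LIMSEQ[OF this \<rho>]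
    have "(\<lambda>n. (u (Suc (\<rho> n)) x / r ^ Suc (\<rho> n) - 1) / Suc (\<rho> n)) \<longlonglongrightarrow> 0"
      by (simp only: o_def)
    then have "(\<lambda>n. \<Lambda> (h (\<rho> n)) x) \<longlonglongrightarrow> r * (v x + 0)"
      unfolding Lambda_h using x by (intro tendsto_intros lim_h) auto
    then show ?thesis
      using LIMSEQ_unique[OF lim_Lambda] by simp
  qed
  moreover have "0 \<le> (-1) ^ k * Re ((deriv ^^ k) g (of_real x)) \<and>
      (-1) ^ k * Re ((deriv ^^ k) g (of_real x)) \<le> pochhammer (2 * s) k / \<gamma> ^ k * v x"
    if x: "0 \<le> x" for k x
  proof -
    \<comment> \<open>Radius 1/2 suffices because \<open>x \<ge> 0\<close> and
      \<open>\<gamma> \<ge> 1\<close>. Uniform convergence on this disc passes to all derivatives at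
      its centre.\<close>
    have sub: "cball (of_real x) (1/2) \<subseteq> ?S"
    proof
      fix z assume "z \<in> cball (complex_of_real x) (1/2)"
      then have "\<bar>Re (of_real x - z)\<bar> \<le> 1/2"
        using abs_Re_le_cmod[of "of_real x - z"] by (simp add: dist_norm)
      then have "x - Re z \<le> 1/2" by (simp only: minus_complex.sel Re_complex_of_real abs_le_iff)
      then show "z \<in> ?S"
        using x gamma by simp
    qed
    then have "uniform_limit (ball (of_real x) (1/2)) (\<lambda>n. H (\<rho> n)) g sequentially"
      using ulim[of "cball (of_real x) (1/2)"] by (auto simp: o_def intro: uniform_limit_on_subset)
    then have "(\<lambda>n. (deriv ^^ k) (H (\<rho> n)) (of_real x)) \<longlonglongrightarrow> (deriv ^^ k) g (of_real x)"
      using pole_cone_holomorphic[OF H] sub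
      by (intro higher_deriv_complex_uniform_limit[where A = "ball (of_real x) (1/2)"] always_eventually)
        (auto intro: holomorphic_on_subset dest: subsetD[OF ball_subset_cball])
    then have lim_deriv: "(\<lambda>n. (-1) ^ k * Re ((deriv ^^ k) (H (\<rho> n)) (of_real x))) \<longlonglongrightarrow>
        (-1) ^ k * Re ((deriv ^^ k) g (of_real x))"
      by (intro tendsto_intros) simp
    have bounds: "0 \<le> (-1) ^ k * Re ((deriv ^^ k) (H n) (of_real x)) \<and>
        (-1) ^ k * Re ((deriv ^^ k) (H n) (of_real x)) \<le> pochhammer (2 * s) k / \<gamma> ^ k * h n x" for n
      using pole_cone_higher_deriv_bounds[OF H, of x k n] x gamma s_pos Re_H[OF x] by simp
    show ?thesis
    proof
      show "0 \<le> (-1) ^ k * Re ((deriv ^^ k) g (of_real x))"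
        by (rule LIMSEQ_le_const[OF lim_deriv]) (use bounds in auto)
      show "(-1) ^ k * Re ((deriv ^^ k) g (of_real x)) \<le> pochhammer (2 * s) k / \<gamma> ^ k * v x"
        using bounds by (intro LIMSEQ_le[OF lim_deriv tendsto_mult_left[OF lim_h[OF x]]]) auto
    qed
  qed
  ultimately show ?thesis
    using that[OF g] v_pos unfolding v_def by blast
qed

section \<open>Uniqueness of the positive eigenfunction\<close>

lemma eigenvalue_pos:
  assumes "\<And>x. x \<in> {0..a} \<Longrightarrow> 0 < v x" "\<And>x. x \<in> {0..a} \<Longrightarrow> \<Lambda> v x = lam * v x"
  shows "0 < lam"
proof -
  have "0 < lam * v 0" "0 < v 0"
    using Lambda_pos[of v 0] assms gamma gamma_le by auto
  then show ?thesis
    by (simp add: zero_less_mult_iff)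
qed

text \<open>By compactness \<open>w \<le> c * v\<close> for some \<open>c\<close>. Iterating at 0
  gives \<open>mu ^ n * w 0 \<le> c * lam ^ n * v 0\<close> for all \<open>n\<close>, which excludes
  \<open>mu > lam\<close>.\<close>

lemma eigenvalue_le:
  assumes "continuous_on {0..a} v" "continuous_on {0..a} w"
    and v: "\<And>x. x \<in> {0..a} \<Longrightarrow> 0 < v x" "\<And>x. x \<in> {0..a} \<Longrightarrow> \<Lambda> v x = lam * v x"
    and w: "\<And>x. x \<in> {0..a} \<Longrightarrow> 0 < w x" "\<And>x. x \<in> {0..a} \<Longrightarrow> \<Lambda> w x = mu * w x"
  shows "mu \<le> lam"
proof (rule ccontr)
  assume "\<not> mu \<le> lam"
  have lam: "0 < lam"
    using eigenvalue_pos v by blast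
  have a: "0 \<in> {0..a}"
    using gamma gamma_le by simp
  have "continuous_on {0..a} (\<lambda>x. w x / v x)"
    using assms by (intro continuous_on_divide) force+
  then obtain x1 where x1: "\<And>x. x \<in> {0..a} \<Longrightarrow> w x / v x \<le> w x1 / v x1"
    using continuous_attains_sup[of "{0..a}" "\<lambda>x. w x / v x"] a by force
  define c where "c = w x1 / v x1"
  have "w x \<le> c * v x" if "x \<in> {0..a}" for x
    using x1[OF that] v(1)[OF that] by (simp add: c_def[symmetric] field_simps)
  then have mono: "(\<Lambda> ^^ n) w 0 \<le> (\<Lambda> ^^ n) (\<lambda>x. c * v x) 0" for n
    using a by (intro Lambda_funpow_mono)
  have "mu ^ n * w 0 \<le> c * (lam ^ n * v 0)" for n
    using mono[of n] Lambda_funpow_eigen[of v lam 0 n, OF v(2) a]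
      Lambda_funpow_eigen[of w mu 0 n, OF w(2) a]
    by (simp add: Lambda_funpow_scale)
  then have bound: "(mu / lam) ^ n \<le> c * v 0 / w 0" for n
    using lam w(1)[OF a] by (simp add: power_divide field_simps)
  have "1 < mu / lam"
    using \<open>\<not> mu \<le> lam\<close> lam by simp
  then obtain n where "c * v 0 / w 0 < (mu / lam) ^ n"
    using real_arch_pow by blast
  with bound[of n] show False by simp
qed

lemma branch_fixed_point:
  assumes "1 \<le> \<beta>"
  obtains p :: real where "0 < p" "p < 1" "p * (p + \<beta>) = 1"
proof
  define p where "p = (sqrt (\<beta>\<^sup>2 + 4) - \<beta>) / 2"
  have "sqrt (\<beta>\<^sup>2) < sqrt (\<beta>\<^sup>2 + 4)"
    by (intro real_sqrt_less_mono) simp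
  then show "0 < p"
    using assms by (simp add: p_def)
  have "sqrt (\<beta>\<^sup>2 + 4) ^ 2 = \<beta>\<^sup>2 + 4"
    by simp
  then show eq: "p * (p + \<beta>) = 1"
    by (simp add: p_def power2_eq_square field_simps)
  show "p < 1"
  proof (rule ccontr)
    assume "\<not> p < 1"
    then have "1 * (1 + \<beta>) \<le> p * (p + \<beta>)"
      using assms by (intro mult_mono) auto
    with eq assms show False by simp
  qed
qed

text \<open>The branch contracts distances to \<open>p\<close> by the factor \<open>p\<close>: its
  value at \<open>y\<close> minus \<open>p\<close> equals
  \<open>p * (p - y) / (y + \<beta>)\<close>, with \<open>y + \<beta> \<ge> 1\<close>.\<close>

lemma branch_orbit_tendsto:
  fixes x p \<beta> :: real
  assumes "1 \<le> \<beta>" "0 \<le> x" "0 < p" "p < 1" "p * (p + \<beta>) = 1"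
  shows "(\<lambda>n. ((\<lambda>y. 1 / (y + \<beta>)) ^^ n) x) \<longlonglongrightarrow> p"
proof -
  let ?T = "\<lambda>y. 1 / (y + \<beta>)"
  have T: "\<bar>?T y - p\<bar> \<le> p * \<bar>y - p\<bar>" if "0 \<le> y" for y
  proof -
    have "?T y - p = (p * (p + \<beta>) - p * (y + \<beta>)) / (y + \<beta>)"
      using assms that by (simp add: diff_divide_distrib)
    also have "\<dots> = p * (p - y) / (y + \<beta>)"
      by (simp add: algebra_simps)
    finally have "\<bar>?T y - p\<bar> = p * \<bar>y - p\<bar> / (y + \<beta>)"
      using assms that by (simp add: abs_mult abs_minus_commute)
    also have "\<dots> \<le> p * \<bar>y - p\<bar> / 1"
      using assms that by (intro divide_left_mono) auto
    finally show ?thesis by simp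
  qed
  have orbit: "0 \<le> (?T ^^ n) x \<and> \<bar>(?T ^^ n) x - p\<bar> \<le> p ^ n * \<bar>x - p\<bar>" for n
  proof (induction n)
    case (Suc n)
    have "\<bar>?T ((?T ^^ n) x) - p\<bar> \<le> p * \<bar>(?T ^^ n) x - p\<bar>"
      using Suc by (intro T) simp
    also have "\<dots> \<le> p * (p ^ n * \<bar>x - p\<bar>)"
      using Suc assms by (intro mult_left_mono) auto
    finally show ?case
      using Suc assms by (simp add: mult.assoc)
  qed (use assms in auto)
  have "(\<lambda>n. (?T ^^ n) x - p) \<longlonglongrightarrow> 0"
  proof (rule Lim_null_comparison)
    show "\<forall>\<^sub>F n in sequentially. norm ((?T ^^ n) x - p) \<le> p ^ n * \<bar>x - p\<bar>"
      using orbit by simp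
    show "(\<lambda>n. p ^ n * \<bar>x - p\<bar>) \<longlonglongrightarrow> 0"
      using assms by (intro tendsto_mult_left_zero LIMSEQ_realpow_zero) auto
  qed
  then show ?thesis
    by (simp add: LIM_zero_iff)
qed

lemma eigenfunction_ratio_min:
  assumes "continuous_on {0..a} v" "continuous_on {0..a} w"
    and v: "\<And>x. x \<in> {0..a} \<Longrightarrow> 0 < v x" "\<And>x. x \<in> {0..a} \<Longrightarrow> \<Lambda> v x = lam * v x"
    and w: "\<And>x. x \<in> {0..a} \<Longrightarrow> \<Lambda> w x = lam * w x"
    and \<beta>: "\<beta> \<in> B" and p: "0 < p" "p < 1" "p * (p + \<beta>) = 1" and x: "x \<in> {0..a}"
  shows "w p / v p \<le> w x / v x"
proof -
  have "continuous_on {0..a} (\<lambda>x. w x / v x)"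
    using assms by (intro continuous_on_divide) force+
  then obtain x0 where x0: "x0 \<in> {0..a}" "\<And>x. x \<in> {0..a} \<Longrightarrow> w x0 / v x0 \<le> w x / v x"
    using continuous_attains_inf[of "{0..a}" "\<lambda>x. w x / v x"] x by force
  define c where "c = w x0 / v x0"
  \<comment> \<open>Minimum points of the ratio become zeros of a nonnegative function satisfying
    the same eigenvalue equation; the form with \<open>+ (- c)\<close> fits
    \<open>Lambda_op_add\<close> and \<open>Lambda_op_scale\<close>.\<close>
  define f where "f x = w x + (- c) * v x" for x
  have f_nonneg: "0 \<le> f y" if "y \<in> {0..a}" for y
    using x0(2)[OF that] v(1)[OF that] by (simp add: f_def c_def[symmetric] field_simps)
  have "f x0 = 0"
    using v(1)[OF x0(1)] by (simp add: f_def c_def)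
  have f_branch: "f (1 / (y + \<beta>)) = 0" if "y \<in> {0..a}" "f y = 0" for y
  proof -
    have "\<Lambda> f y = lam * f y"
      unfolding f_def Lambda_op_add Lambda_op_scale using v(2) w that by (simp add: algebra_simps)
    then have "(\<Sum>\<beta>\<in>B. (y + \<beta>) powr (- 2 * s) * f (1 / (y + \<beta>))) = 0"
      using that by (simp add: Lambda_op_def)
    \<comment> \<open>A vanishing sum of nonnegative terms vanishes termwise, and the weight of the
      chosen branch is positive.\<close>
    moreover have "0 \<le> (y + \<beta>') powr (- 2 * s) * f (1 / (y + \<beta>'))" if "\<beta>' \<in> B" for \<beta>'
      using f_nonneg[OF branch_in[OF that]] \<open>y \<in> {0..a}\<close> by simp
    ultimately have "(y + \<beta>) powr (- 2 * s) * f (1 / (y + \<beta>)) = 0"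
      using \<beta> finite_B sum_nonneg_eq_0_iff[of B "\<lambda>\<beta>. (y + \<beta>) powr (- 2 * s) * f (1 / (y + \<beta>))"] by blast
    then show ?thesis
      using weight_pos[OF \<beta>, of y] that by simp
  qed
  let ?T = "\<lambda>y. 1 / (y + \<beta>)"
  have orbit: "(?T ^^ n) x0 \<in> {0..a} \<and> f ((?T ^^ n) x0) = 0" for n
  proof (induction n)
    case 0
    show ?case using x0(1) \<open>f x0 = 0\<close> by simp
  next
    case (Suc n)
    then show ?case
      using f_branch[of "(?T ^^ n) x0"] branch_in[OF \<beta>, of "(?T ^^ n) x0"] by simp
  qed
  have "1 \<le> \<beta>"
    using \<beta> B_ge gamma by force
  then have tendsto_p: "(\<lambda>n. (?T ^^ n) x0) \<longlonglongrightarrow> p"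
    using x0(1) p by (intro branch_orbit_tendsto) auto
  have p_in: "p \<in> {0..a}"
    using p gamma gamma_le by simp
  have "continuous_on {0..a} f"
    unfolding f_def using assms by (intro continuous_intros)
  then have "(\<lambda>n. f ((?T ^^ n) x0)) \<longlonglongrightarrow> f p"
    by (rule continuous_on_tendsto_compose[OF _ tendsto_p p_in]) (use orbit in auto)
  then have "f p = 0"
    using orbit by (simp add: LIMSEQ_const_iff)
  then have "w p / v p = c"
    using v(1)[OF p_in] by (simp add: f_def)
  then show ?thesis
    using x0(2)[OF x] by (simp add: c_def)
qed

theorem eigenfunction_unique:
  assumes "continuous_on {0..a} v" "continuous_on {0..a} w"
    and v: "\<And>x. x \<in> {0..a} \<Longrightarrow> 0 < v x" "\<And>x. x \<in> {0..a} \<Longrightarrow> \<Lambda> v x = lam * v x"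
    and w: "\<And>x. x \<in> {0..a} \<Longrightarrow> 0 < w x" "\<And>x. x \<in> {0..a} \<Longrightarrow> \<Lambda> w x = mu * w x"
  shows "\<exists>c>0. \<forall>x\<in>{0..a}. w x = c * v x"
proof -
  have "mu = lam"
    using eigenvalue_le[OF assms] eigenvalue_le[OF assms(2,1) w v] by simp
  obtain \<beta> where \<beta>: "\<beta> \<in> B"
    using nonempty_B by blast
  then have "1 \<le> \<beta>"
    using B_ge gamma by force
  then obtain p where p: "0 < p" "p < 1" "p * (p + \<beta>) = 1"
    using branch_fixed_point by blast
  have p_in: "p \<in> {0..a}"
    using p gamma gamma_le by simp
  have "w x = w p / v p * v x" if x: "x \<in> {0..a}" for x
  proof -
    have "w p / v p \<le> w x / v x"
      using assms p \<beta> x unfolding \<open>mu = lam\<close> by (intro eigenfunction_ratio_min[of v w lam \<beta>]) auto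
    \<comment> \<open>Exchanging \<open>v\<close> and \<open>w\<close> turns the minimum statement
      into one about the maximum of \<open>w / v\<close>, attained at the same
      \<open>p\<close>.\<close>
    moreover have "v p / w p \<le> v x / w x"
      using assms p \<beta> x unfolding \<open>mu = lam\<close> by (intro eigenfunction_ratio_min[of w v lam \<beta>]) auto
    ultimately show ?thesis
      using v(1)[OF x] w(1)[OF x] v(1)[OF p_in] w(1)[OF p_in] by (simp add: field_simps)
  qed
  then show ?thesis
    using v(1)[OF p_in] w(1)[OF p_in] by (intro exI[of _ "w p / v p"]) auto
qed

end

section \<open>The eigenvector on the closed interval and its derivative bounds\<close>

text \<open>Uniqueness after normalization is encoded as uniqueness up to a positive factor, so no
  particular norm is fixed. The competing \<open>w\<close> may belong to any eigenvalue
  \<open>mu\<close>.\<close>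

theorem theorem7p14:
  fixes \<gamma> a s :: real and B :: "real set" and m :: nat
  assumes "\<gamma> \<ge> 1" and "finite B" and "B \<noteq> {}" and "\<forall>\<beta>\<in>B. \<beta> \<ge> \<gamma>"
    and "\<gamma> \<le> a" and "m > 0" and "s > 0"
  shows "\<exists>v lam. Cm_bar m a v \<and> (\<forall>x\<in>{0..a}. v x > 0)
      \<and> (\<forall>x\<in>{0..a}. Lambda_op s B v x = lam * v x)
      \<and> (\<forall>w mu. Cm_bar m a w \<and> (\<forall>x\<in>{0..a}. w x > 0)
              \<and> (\<forall>x\<in>{0..a}. Lambda_op s B w x = mu * w x)
              \<longrightarrow> (\<exists>c>0. \<forall>x\<in>{0..a}. w x = c * v x))
      \<and> (\<forall>k. Cm_bar k a v)
      \<and> (\<forall>\<nu>\<ge>1. \<forall>x\<in>{0..a}.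
            0 \<le> (-1) ^ \<nu> * Dbar a \<nu> v x / v x \<and>
            (-1) ^ \<nu> * Dbar a \<nu> v x / v x \<le> pochhammer (2 * s) \<nu> / \<gamma> ^ \<nu>)"
proof -
  interpret gauss_type_operator \<gamma> a s B
    using assms by unfold_locales auto
  obtain g r where g: "g holomorphic_on {z. - \<gamma> < Re z}"
    and pos: "\<And>x. x \<in> {0..a} \<Longrightarrow> 0 < Re (g (of_real x))"
    and eigen: "\<And>x. x \<in> {0..a} \<Longrightarrow> \<Lambda> (\<lambda>y. Re (g (of_real y))) x = r * Re (g (of_real x))"
    and bounds: "\<And>k x. 0 \<le> x \<Longrightarrow> 0 \<le> (-1) ^ k * Re ((deriv ^^ k) g (of_real x)) \<and>
      (-1) ^ k * Re ((deriv ^^ k) g (of_real x)) \<le> pochhammer (2 * s) k / \<gamma> ^ k * Re (g (of_real x))"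
    by (rule eigenfunction_exists) blast
  define v where "v = (\<lambda>x. Re (g (of_real x)))"
  have Cm: "Cm_bar k a v" for k
    unfolding v_def using g assms by (intro Cm_bar_Re_of_real) auto
  have Dbar: "Dbar a k v x = Re ((deriv ^^ k) g (of_real x))" if "x \<in> {0..a}" for k x
    unfolding v_def using g assms that by (intro Dbar_Re_of_real) auto
  have v: "0 < v x" "\<Lambda> v x = r * v x" if "x \<in> {0..a}" for x
    unfolding v_def using pos[OF that] eigen[OF that] .
  have unique: "\<exists>c>0. \<forall>x\<in>{0..a}. w x = c * v x"
    if "Cm_bar m a w" "\<forall>x\<in>{0..a}. 0 < w x" "\<forall>x\<in>{0..a}. \<Lambda> w x = mu * w x" for w mu
    using that Cm[of m] v
    by (intro eigenfunction_unique[of v w r mu]) (auto simp: Cm_bar_def)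
  have "0 \<le> (-1) ^ \<nu> * Dbar a \<nu> v x / v x \<and>
      (-1) ^ \<nu> * Dbar a \<nu> v x / v x \<le> pochhammer (2 * s) \<nu> / \<gamma> ^ \<nu>" if "x \<in> {0..a}" for \<nu> x
  proof -
    have "0 \<le> (-1) ^ \<nu> * Dbar a \<nu> v x"
      "(-1) ^ \<nu> * Dbar a \<nu> v x \<le> pochhammer (2 * s) \<nu> / \<gamma> ^ \<nu> * v x"
      unfolding Dbar[OF that] unfolding v_def using bounds[of x \<nu>] that by auto
    then show ?thesis
      using v(1)[OF that] by (simp only: pos_divide_le_eq zero_le_divide_iff) simp
  qed
  then show ?thesis
    using Cm unique v by (intro exI[of _ v] exI[of _ r]) blast
qed

end
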